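(* Let $m\ge2$ be an integer. Define $sf(n,m)$ for integers $n$ by $sf(n,m)=0$ for $n<0$, $sf(0,m)=1$, and for $n>0$: $sf(n,m)=sf(n/m,m)$ if $n\equiv0\pmod m$, and $sf(n,m)=sf(n-r,m)+sf(n-m,m)$ if $n\equiv r\pmod m$ with $0<r<m$. Let $1\le r\le m-1$ and let $k$ be an integer with $k\equiv m+r\pmod{2m}$ and $k\le m^2+r$. If $i\ge0$ and $n=m^ik$ satisfies $n\ge0$, then $sf(n,m)$ is even.
   Context: $sf(n,m)$ is the number of semi-$m$-Fibonacci partitions of $n$, characterized by the stated recurrence. *)

theory Defs
  imports "HOL-Number_Theory.Cong"
begin

text \<open>
  For \<^term>\<open>m < 2\<close> the recurrence is not well-founded; there \<^term>\<open>sf n m\<close> is set to the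
  arbitrary value \<^term>\<open>0 :: nat\<close>. In the two recursive branches \<^term>\<open>n mod m\<close> is the residue
  \<open>r\<close> of the recurrence, and \<^term>\<open>n div m\<close> is the exact quotient.
\<close>

function sf :: "int \<Rightarrow> int \<Rightarrow> nat" where
  "sf n m =
     (if m < 2 then 0
      else if n < 0 then 0
      else if n = 0 then 1
      else if n mod m = 0 then sf (n div m) m
      else sf (n - n mod m) m + sf (n - m) m)"
  by auto
termination
proof (relation "measure (\<lambda>(n, m). nat n)", goal_cases)
  case 1
  show ?case by simp
next
  case (2 n m)
  then have "n div m < n" by (intro int_div_less_self) auto
  with 2 show ?case by auto
next
  case (3 n m)
  then have "n mod m > 0" using pos_mod_sign[of m n] by linarith
  with 3 show ?case by auto
next
  case (4 n m)
  then show ?case by auto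
qed

declare sf.simps [simp del]

lemma sf_neg: "sf n m = 0" if "m \<ge> 2" "n < 0"
  using that by (subst sf.simps) simp

lemma sf_zero: "sf 0 m = 1" if "m \<ge> 2"
  using that by (subst sf.simps) simp

lemma sf_multiple: "sf n m = sf (n div m) m" if "m \<ge> 2" "n > 0" "[n = 0] (mod m)"
  using that by (subst sf.simps) (simp add: cong_def)

lemma sf_nonmultiple: "sf n m = sf (n - r) m + sf (n - m) m"
  if "m \<ge> 2" "n > 0" "0 < r" "r < m" "[n = r] (mod m)"
proof -
  have "n mod m = r" using that by (simp add: cong_def)
  with that show ?thesis by (subst sf.simps) simp
qed

end

theory Submission
  imports Defs
begin

text \<open>
  Write \<open>k = q m + r\<close> with \<open>q\<close> odd and \<open>q \<le> m\<close>. Unrolling the recurrence gives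
  \<open>sf(k, m) = sf(0, m) + sf(m, m) + \<dots> + sf(q m, m)\<close>, and each summand equals
  \<open>sf(t, m)\<close> for some \<open>0 \<le> t \<le> m\<close>, which is 1. Hence \<open>sf(k, m) = q + 1\<close> is even,
  and multiplying by powers of \<open>m\<close> does not change the value.
\<close>

lemma sf_mult_modulus:
  assumes "m \<ge> 2" "n \<ge> 0"
  shows "sf (m * n) m = sf n m"
proof (cases "n = 0")
  case False
  with assms have "m * n > 0" by simp
  with assms show ?thesis by (simp add: sf_multiple cong_def)
qed simp

lemma sf_mult_power:
  assumes "m \<ge> 2" "n \<ge> 0"
  shows "sf (m ^ i * n) m = sf n m"
proof (induction i)
  case (Suc i)
  have "sf (m * (m ^ i * n)) m = sf (m ^ i * n) m"
    using assms by (intro sf_mult_modulus) auto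
  with Suc show ?case by (simp add: mult.assoc)
qed simp

lemma sf_less_modulus:
  assumes "m \<ge> 2" "0 \<le> n" "n < m"
  shows "sf n m = 1"
proof (cases "n = 0")
  case False
  \<comment> \<open>Here \<open>n\<close> is its own residue, so one summand is
    \<open>sf 0 m\<close> and the other has a negative argument.\<close>
  with assms have "sf n m = sf (n - n) m + sf (n - m) m"
    by (intro sf_nonmultiple) auto
  with assms show ?thesis by (simp add: sf_neg sf_zero)
qed (use assms in \<open>simp add: sf_zero\<close>)

text \<open>The endpoint \<open>n = m\<close> reduces to \<open>sf 1 m\<close>; it is included
  because the quotient \<open>q\<close> can reach \<open>m\<close> when \<open>m\<close> is
  odd.\<close>

lemma sf_le_modulus:
  assumes "m \<ge> 2" "0 \<le> n" "n \<le> m"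
  shows "sf n m = 1"
  using assms sf_less_modulus[of m n] sf_mult_modulus[of m 1] sf_less_modulus[of m 1]
  by (cases "n = m") auto

lemma sf_mult_modulus_add:
  assumes "m \<ge> 2" "0 < r" "r < m" "int q \<le> m"
  shows "sf (m * int q + r) m = q + 1"
  using \<open>int q \<le> m\<close>
proof (induction q)
  case 0
  with assms show ?case by (simp add: sf_less_modulus)
next
  case (Suc q)
  let ?n = "m * int (Suc q) + r"
  have "?n > 0" using assms by (intro add_nonneg_pos) auto
  moreover have "[?n = r] (mod m)" by (simp add: cong_def)
  ultimately have "sf ?n m = sf (?n - r) m + sf (?n - m) m"
    using assms by (intro sf_nonmultiple) auto
  also have "sf (?n - r) m = sf (int (Suc q)) m"
    using assms sf_mult_modulus[of m "int (Suc q)"] by simp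
  \<comment> \<open>The bound on \<open>q\<close> keeps this quotient within the range where
    \<open>sf\<close> is constantly 1.\<close>
  also have "\<dots> = 1"
    using assms Suc.prems by (intro sf_le_modulus) auto
  also have "?n - m = m * int q + r" by (simp add: algebra_simps)
  finally show ?case using Suc by simp
qed

theorem theorem7:
  fixes m r k n :: int and i :: nat
  assumes "m \<ge> 2"
    and "1 \<le> r" and "r \<le> m - 1"
    and "[k = m + r] (mod (2 * m))"
    and "k \<le> m\<^sup>2 + r"
    and "n = m ^ i * k"
    and "n \<ge> 0"
  shows "even (sf n m)"
proof -
  have "m ^ i > 0" using assms(1) by simp
  then have "k \<ge> 0"
    using assms(6,7) zero_le_mult_iff[of "m ^ i" k] by linarith
  from assms(4) obtain j where "k = m + r + 2 * m * j"
    by (metis cong_iff_lin cong_sym)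
  then have k: "k = m * (2 * j + 1) + r" by (simp add: algebra_simps)
  \<comment> \<open>Since \<open>k\<close> is nonnegative and \<open>r < m\<close>, the multiple of
    \<open>m\<close> in \<open>k\<close> exceeds \<open>-m\<close>; as \<open>2 * j + 1\<close> is
    odd, it is then at least 1.\<close>
  have "m * (2 * j + 1) > m * (-1)" using k \<open>k \<ge> 0\<close> assms by simp
  then have "2 * j + 1 > -1" using assms(1) by (subst (asm) mult_less_cancel_left_pos) auto
  then have "j \<ge> 0" by simp
  have "m * (2 * j + 1) \<le> m * m" using k assms by (simp add: power2_eq_square)
  then have "2 * j + 1 \<le> m" using assms(1) by (subst (asm) mult_le_cancel_left_pos) auto
  with \<open>j \<ge> 0\<close> assms k have "sf k m = nat (2 * j + 1) + 1"
    using sf_mult_modulus_add[of m r "nat (2 * j + 1)"] by simp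
  then have "even (sf k m)" using \<open>j \<ge> 0\<close> by (simp add: even_nat_iff)
  with \<open>k \<ge> 0\<close> assms show ?thesis by (simp add: sf_mult_power)
qed

end
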